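(* Let $r\ge 1$. Let $X$ be an $(r+1)$-partite $r$-dimensional simplicial complex, with partite sets $V_1,\ldots,V_{r+1}$. Let $1\le k\le f_{r-1}(X)$. Then \[ \sum_{i=1}^k \lambda_i(L^+_{r-1}(X))\le \sum_{j=1}^{r+1} \; \sum_{i=1}^{\min\{k,|X(r-1;j)|\}} d_{i}^{(r)}(X;j). \]
   Context: A simplicial complex $X$ on a finite vertex set $V$ is a family of subsets of $V$ closed under inclusion; its elements are called simplices (or faces), $\dim(\sigma)=|\sigma|-1$ for $\sigma\in X$, and $\dim(X)$ is the maximal dimension of a simplex. $X(i)$ is the set of $i$-dimensional simplices (with $X(-1)=\{\emptyset\}$) and $f_i(X)=|X(i)|$. For $\sigma\in X$ and $1\le r\le\dim(X)$, the $r$-degree $\deg_X^{(r)}(\sigma)$ is the number of $r$-dimensional simplices of $X$ containing $\sigma$. An $r$-dimensional simplicial complex $X$ is $(r+1)$-partite with partite sets $V_1,\ldots,V_{r+1}$ if $V_1,\ldots,V_{r+1}$ is a partition of $V$ such that $|\sigma\cap V_i|\le 1$ for every $\sigma\in X$ and $1\le i\le r+1$. For $1\le j\le r+1$, $X(r-1;j)$ is the set of $(r-1)$-dimensional simplices of $X$ that do not intersect $V_j$, and for $1\le i\le |X(r-1;j)|$, $d_i^{(r)}(X;j)$ is the $i$-th largest (with multiplicity) $r$-degree of a simplex in $X(r-1;j)$. Fix an arbitrary linear order $<$ on $V$. For $\sigma\in X(s-1)$, $\tau\in X(s)$ with $\sigma\subset\tau$ ($0\le s\le \dim(X)$), let $u$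 be the unique vertex of $\tau\setminus\sigma$ and set $(\tau:\sigma)=(-1)^{|\{v\in\tau:\,v<u\}|}$. For $1\le r\le\dim(X)$, the upper Laplacian $L_{r-1}^+(X)\in\mathbb{R}^{f_{r-1}(X)\times f_{r-1}(X)}$ is the matrix indexed by $X(r-1)$ with $L_{r-1}^+(X)_{\tau,\tau}=\deg_X^{(r)}(\tau)$; $L_{r-1}^+(X)_{\tau,\eta}=-(\tau:\tau\cap\eta)(\eta:\tau\cap\eta)$ if $|\tau\cap\eta|=r-1$ and $\tau\cup\eta\in X$; and all other entries $0$. For a symmetric real matrix $M$, $\lambda_i(M)$ is its $i$-th largest eigenvalue (with multiplicity). *)

theory Defs
  imports
    "Jordan_Normal_Form.Char_Poly"
    "HOL-Library.Multiset"
    "HOL-Library.Disjoint_Sets"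
begin

(* Dimensions are integers, so that the empty simplex has dimension -1. *)
definition simplex_dim :: "'a set \<Rightarrow> int" where
  "simplex_dim \<sigma> = int (card \<sigma>) - 1"

(* Asking for the empty simplex excludes only the void family and makes faces X (-1) = {{}}.
   Elements of V need not be vertices of X. *)
definition simplicial_complex :: "'a set \<Rightarrow> 'a set set \<Rightarrow> bool" where
  "simplicial_complex V X \<longleftrightarrow>
     finite V \<and> X \<subseteq> Pow V \<and> {} \<in> X \<and> (\<forall>\<sigma>\<in>X. \<forall>\<tau>. \<tau> \<subseteq> \<sigma> \<longrightarrow> \<tau> \<in> X)"

definition complex_dim :: "'a set set \<Rightarrow> int" where
  "complex_dim X = Max (simplex_dim ` X)"

definition faces :: "'a set set \<Rightarrow> int \<Rightarrow> 'a set set" where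
  "faces X i = {\<sigma> \<in> X. simplex_dim \<sigma> = i}"

definition r_degree :: "'a set set \<Rightarrow> nat \<Rightarrow> 'a set \<Rightarrow> nat" where
  "r_degree X r \<sigma> = card {\<tau> \<in> faces X (int r). \<sigma> \<subseteq> \<tau>}"

(* The partite sets are P 1, ..., P (r+1). Their nonemptiness is automatic: a simplex of
   dimension r has r + 1 vertices, at most one in each part. *)
definition partite_complex :: "'a set \<Rightarrow> 'a set set \<Rightarrow> nat \<Rightarrow> (nat \<Rightarrow> 'a set) \<Rightarrow> bool" where
  "partite_complex V X r P \<longleftrightarrow>
     simplicial_complex V X \<and> complex_dim X = int r \<and>
     (\<Union>i\<in>{1..r+1}. P i) = V \<and> disjoint_family_on P {1..r+1} \<and>
     (\<forall>\<sigma>\<in>X. \<forall>i\<in>{1..r+1}. card (\<sigma> \<inter> P i) \<le> 1)"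

(* X(i;j) for W = P j *)
definition faces_avoiding :: "'a set set \<Rightarrow> int \<Rightarrow> 'a set \<Rightarrow> 'a set set" where
  "faces_avoiding X i W = {\<sigma> \<in> faces X i. \<sigma> \<inter> W = {}}"

(* Counted from 1, with multiplicity; meaningful for 1 <= i <= size M. *)
definition nth_largest :: "'b::linorder multiset \<Rightarrow> nat \<Rightarrow> 'b" where
  "nth_largest M i = rev (sorted_list_of_multiset M) ! (i - 1)"

(* d_i^(r)(X;j) for W = P j *)
definition degree_seq :: "'a set set \<Rightarrow> nat \<Rightarrow> 'a set \<Rightarrow> nat \<Rightarrow> nat" where
  "degree_seq X r W i =
     nth_largest (image_mset (r_degree X r) (mset_set (faces_avoiding X (int r - 1) W))) i"

(* The sign (\<tau> : \<sigma>), for \<tau> - \<sigma> = {u}; lt is the strict order on the vertices. *)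
definition incidence_sign :: "'a rel \<Rightarrow> 'a set \<Rightarrow> 'a set \<Rightarrow> real" where
  "incidence_sign lt \<tau> \<sigma> = (-1) ^ card {v \<in> \<tau>. (v, the_elem (\<tau> - \<sigma>)) \<in> lt}"

definition upper_laplacian_entry ::
  "'a rel \<Rightarrow> 'a set set \<Rightarrow> nat \<Rightarrow> 'a set \<Rightarrow> 'a set \<Rightarrow> real" where
  "upper_laplacian_entry lt X r \<tau> \<eta> =
     (if \<tau> = \<eta> then real (r_degree X r \<tau>)
      else if card (\<tau> \<inter> \<eta>) = r - 1 \<and> \<tau> \<union> \<eta> \<in> X
        then - (incidence_sign lt \<tau> (\<tau> \<inter> \<eta>) * incidence_sign lt \<eta> (\<tau> \<inter> \<eta>))
      else 0)"

(* The matrix of L_(r-1)^+(X). Matrices of Jordan_Normal_Form are indexed by {0..<n}, so the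
   rows and columns are numbered by a list fs that enumerates faces X (int r - 1). *)
definition upper_laplacian ::
  "'a rel \<Rightarrow> 'a set set \<Rightarrow> nat \<Rightarrow> 'a set list \<Rightarrow> real mat" where
  "upper_laplacian lt X r fs =
     mat (length fs) (length fs) (\<lambda>(i, j). upper_laplacian_entry lt X r (fs ! i) (fs ! j))"

(* Eigenvalues with their multiplicity as roots of the characteristic polynomial. A symmetric
   real matrix of size n has exactly n of them, all real. *)
definition nth_eigenvalue :: "real mat \<Rightarrow> nat \<Rightarrow> real" where
  "nth_eigenvalue M i = nth_largest (proots (char_poly M)) i"

end

theory Submission
  imports
    Defs
    "Jordan_Normal_Form.Spectral_Radius"
    "Jordan_Normal_Form.Schur_Decomposition"
begin

text \<open>
  Let $u_i$ be orthonormal eigenvectors of the positive semidefinite matrix $L = L^+_{r-1}(X)$, with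
  eigenvalues $l_i$, let $S$ index the $k$ largest ones and put $w(t) = \sum_{i \in S} l_i u_i(t)^2$.
  Then $w$ sums to the left-hand side, and $w(t) \le L(t,t) = \deg(t)$ because the full sum over all
  $i$ is $L(t,t)$. A simplex with $r$ vertices misses exactly one part, and two simplices
  missing the same part have no common coface, so the faces missing a given part index a diagonal
  block of $L$. On such a block semidefiniteness gives the Bessel inequality
  $\sum_t (L u)(t)^2 / \deg(t) \le u^T L u$; for $u = u_i$ with $i \in S$ these bound the sum of
  $x(t) = w(t) / \deg(t)$ over the block by $k$. Since $0 \le x \le 1$, the sum of
  $w(t) = \deg(t) x(t)$ over the block is at most the sum of its $k$ largest degrees.
\<close>

section \<open>Diagonalization of real symmetric matrices\<close>

text \<open>Over the complex numbers an eigenvalue \<open>z\<close> with eigenvector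
  \<open>v\<close> exists. Evaluating the Hermitian form at \<open>v\<close> by rows and by columns
  gives \<open>z * N = cnj z * N\<close>, where \<open>N\<close> is the squared norm of
  \<open>v\<close>, so \<open>z\<close> is real.\<close>

lemma real_symmetric_eigenvalue_exists:
  fixes A :: "real mat"
  assumes A: "A \<in> carrier_mat n n" and sym: "A\<^sup>T = A" and n: "n > 0"
  shows "\<exists>e. eigenvalue A e"
proof -
  define C where "C = map_mat complex_of_real A"
  have C: "C \<in> carrier_mat n n" using A by (simp add: C_def)
  obtain z where "z \<in> spectrum C" using spectrum_non_empty[OF C n] by blast
  then have ev: "eigenvalue C z" by (simp add: spectrum_def)
  then obtain v where v: "v \<in> carrier_vec n" "v \<noteq> 0\<^sub>v n" "C *\<^sub>v v = z \<cdot>\<^sub>v v"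
    unfolding eigenvalue_def eigenvector_def using C by auto
  have row: "(\<Sum>j<n. C $$ (i, j) * v $ j) = z * v $ i" if "i < n" for i
    using arg_cong[OF v(3), of "\<lambda>w. w $ i"] that C v(1)
    by (auto simp: scalar_prod_def atLeast0LessThan intro!: sum.cong)
  have C_sym: "C $$ (i, j) = C $$ (j, i)" "cnj (C $$ (i, j)) = C $$ (i, j)"
    if "i < n" "j < n" for i j
    using arg_cong[OF sym, of "\<lambda>M. M $$ (i, j)"] that A by (auto simp: C_def)
  define N where "N = (\<Sum>i<n. v $ i * cnj (v $ i))"
  have "z * N = (\<Sum>i<n. \<Sum>j<n. C $$ (i, j) * v $ j * cnj (v $ i))"
    unfolding N_def sum_distrib_left
    by (intro sum.cong refl) (simp add: row[symmetric] sum_distrib_right mult.assoc[symmetric])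
  also have "\<dots> = (\<Sum>j<n. \<Sum>i<n. C $$ (i, j) * v $ j * cnj (v $ i))"
    by (rule sum.swap)
  also have "\<dots> = (\<Sum>j<n. v $ j * cnj (\<Sum>i<n. C $$ (j, i) * v $ i))"
    by (intro sum.cong refl) (auto simp: sum_distrib_left C_sym ac_simps intro!: sum.cong)
  also have "\<dots> = cnj z * N"
    unfolding N_def sum_distrib_left by (intro sum.cong refl) (simp add: row)
  finally have "z * N = cnj z * N" .
  moreover have "N \<noteq> 0"
  proof
    assume "N = 0"
    moreover have "N = of_real (\<Sum>i<n. (cmod (v $ i))\<^sup>2)"
      unfolding N_def by (simp only: complex_norm_square of_real_sum)
    ultimately have "(\<Sum>i<n. (cmod (v $ i))\<^sup>2) = 0" using of_real_eq_0_iff by metis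
    then have "\<forall>i<n. v $ i = 0" by (simp add: sum_nonneg_eq_0_iff)
    with v show False by (metis eq_vecI carrier_vecD index_zero_vec)
  qed
  ultimately have "z = cnj z" by simp
  then have z: "z = of_real (Re z)" by (simp add: complex_eq_iff)
  have "poly (char_poly C) z = 0" using ev eigenvalue_root_char_poly[OF C] by simp
  \<comment> \<open>The embedding of the reals is injective and commutes with
    \<open>char_poly\<close>, so the root descends to \<open>A\<close>.\<close>
  then have "complex_of_real (poly (char_poly A) (Re z)) = 0"
    by (subst (asm) z) (simp add: C_def of_real_hom.char_poly_hom[OF A])
  then show ?thesis using eigenvalue_root_char_poly[OF A] by auto
qed

text \<open>Gram-Schmidt on a basis starting with \<open>v\<close> keeps \<open>v\<close> in first
  place. Dividing each vector by its length yields \<open>W\<close>, and \<open>c\<close> is the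
  reciprocal length of \<open>v\<close>.\<close>

lemma orthogonal_matrix_with_first_col:
  fixes v :: "real vec"
  assumes v: "v \<in> carrier_vec n" "v \<noteq> 0\<^sub>v n"
  obtains W c where "W \<in> carrier_mat n n" "W\<^sup>T * W = 1\<^sub>m n" "col W 0 = c \<cdot>\<^sub>v v"
proof -
  interpret cof_vec_space n "TYPE(real)" .
  define ws where "ws = gram_schmidt n (basis_completion v)"
  note bc = basis_completion[OF v]
  have n: "n > 0" using v by (cases n) auto
  obtain vs where vs: "basis_completion v = v # vs"
    using bc n by (cases "basis_completion v") auto
  note gs = gram_schmidt_result[OF bc(2) bc(4) bc(5) ws_def]
  have ws: "length ws = n" "\<And>i. i < n \<Longrightarrow> ws ! i \<in> carrier_vec n" "ws ! 0 = v"
    using gs bc(6) n gram_schmidt_hd[OF v(1), of vs]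
    by (auto simp: vs ws_def hd_conv_nth[symmetric] simp flip: length_greater_0_conv)
  define s where "s j = sqrt (ws ! j \<bullet> ws ! j)" for j
  define W where "W = mat n n (\<lambda>(i, j). ws ! j $ i / s j)"
  have pos: "ws ! j \<bullet> ws ! j > 0" if "j < n" for j
  proof -
    have "ws ! j \<bullet> ws ! j \<ge> 0"
      by (auto simp: scalar_prod_def intro!: sum_nonneg)
    then show ?thesis using corthogonalD[OF gs(2), of j j] that ws(1) by simp
  qed
  have W: "W \<in> carrier_mat n n" by (simp add: W_def)
  have "W\<^sup>T * W = 1\<^sub>m n"
  proof (rule eq_matI)
    fix i j assume "i < dim_row (1\<^sub>m n :: real mat)" "j < dim_col (1\<^sub>m n :: real mat)"
    then have ij: "i < n" "j < n" by auto
    have "(W\<^sup>T * W) $$ (i, j) = (ws ! i \<bullet> ws ! j) / (s i * s j)"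
      using ij ws(2)[of i] ws(2)[of j]
      by (auto simp: W_def scalar_prod_def sum_divide_distrib intro!: sum.cong)
    then show "(W\<^sup>T * W) $$ (i, j) = 1\<^sub>m n $$ (i, j)"
      using ij corthogonalD[OF gs(2), of i j] pos[OF ij(1)] ws
      by (auto simp: s_def)
  qed (auto simp: W_def)
  moreover have "col W 0 = (1 / s 0) \<cdot>\<^sub>v v"
    using n v ws by (intro eq_vecI) (auto simp: W_def)
  ultimately show ?thesis using W that by blast
qed

text \<open>Deflation: in an orthonormal basis starting with an eigenvector, symmetry splits the
  matrix into a 1 by 1 block and a symmetric block of size \<open>n\<close>, to which the induction
  hypothesis applies.\<close>

theorem real_symmetric_diagonalization:
  fixes A :: "real mat"
  assumes "A \<in> carrier_mat n n" and "A\<^sup>T = A"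
  shows "\<exists>U l. U \<in> carrier_mat n n \<and> U\<^sup>T * U = 1\<^sub>m n \<and> U\<^sup>T * A * U = mat_diag n l"
  using assms
proof (induction n arbitrary: A)
  case 0
  then show ?case
    by (intro exI[of _ "1\<^sub>m 0"] exI[of _ "\<lambda>_. 0"]) (auto simp: mat_diag_def)
next
  case (Suc n)
  let ?N = "Suc n"
  note A = Suc.prems(1)
  obtain e where "eigenvalue A e" using real_symmetric_eigenvalue_exists[OF Suc.prems] by auto
  then obtain v where v: "v \<in> carrier_vec ?N" "v \<noteq> 0\<^sub>v ?N" and Av: "A *\<^sub>v v = e \<cdot>\<^sub>v v"
    unfolding eigenvalue_def eigenvector_def using A by auto
  obtain W c where W: "W \<in> carrier_mat ?N ?N" and WW: "W\<^sup>T * W = 1\<^sub>m ?N"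
    and Wv: "col W 0 = c \<cdot>\<^sub>v v"
    using orthogonal_matrix_with_first_col[OF v] .
  have WT: "W\<^sup>T \<in> carrier_mat ?N ?N" using W by simp
  define M where "M = W\<^sup>T * A * W"
  have M: "M \<in> carrier_mat ?N ?N" using A W by (auto simp: M_def)
  have MT: "M\<^sup>T = M" unfolding M_def
    using A W WT Suc.prems(2)
    by (simp add: transpose_mult[of _ ?N ?N _ ?N] assoc_mult_mat[of _ ?N ?N _ ?N _ ?N])
  have "A *\<^sub>v col W 0 = e \<cdot>\<^sub>v col W 0"
    using Wv Av v A by (simp add: mult_mat_vec smult_smult_assoc mult.commute)
  moreover have colW: "col W 0 \<in> carrier_vec ?N" using W col_dim[of W 0] by simp
  moreover have "M = W\<^sup>T * (A * W)"
    using A W WT unfolding M_def by (simp add: assoc_mult_mat[of _ ?N ?N _ ?N _ ?N])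
  ultimately have "col M 0 = W\<^sup>T *\<^sub>v (e \<cdot>\<^sub>v col W 0)"
    using A W by (simp only: col_mult2[OF WT mult_carrier_mat[OF A W] zero_less_Suc]
      col_mult2[OF A W zero_less_Suc])
  also have "\<dots> = e \<cdot>\<^sub>v col (W\<^sup>T * W) 0"
    by (simp only: mult_mat_vec[OF WT colW] col_mult2[OF WT W zero_less_Suc])
  finally have col0: "col M 0 = e \<cdot>\<^sub>v unit_vec ?N 0" by (simp add: WW)
  obtain M1 M2 M3 M4 where split: "split_block M 1 1 = (M1, M2, M3, M4)"
    by (cases "split_block M 1 1") auto
  have dims: "dim_row M = 1 + n" "dim_col M = 1 + n" using M by auto
  note Mb = split_block[OF split dims]
  \<comment> \<open>The column comes from \<open>col0\<close>, the row from the symmetry of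
    \<open>M\<close>.\<close>
  have entry0: "M $$ (i, 0) = (if i = 0 then e else 0)" "M $$ (0, i) = (if i = 0 then e else 0)"
    if "i < ?N" for i
    using arg_cong[OF col0, of "\<lambda>w. w $ i"] arg_cong[OF MT, of "\<lambda>w. w $$ (0, i)"] M that
    by auto
  have M4T: "M4\<^sup>T = M4"
  proof (rule eq_matI)
    fix i j assume "i < dim_row M4" "j < dim_col M4"
    then show "M4\<^sup>T $$ (i, j) = M4 $$ (i, j)"
      using arg_cong[OF MT, of "\<lambda>w. w $$ (Suc i, Suc j)"] M Mb(4)
        split[unfolded split_block_def Let_def] by auto
  qed (use Mb(4) in auto)
  have blocks: "M1 = mat_diag 1 (\<lambda>_. e)" "M2 = 0\<^sub>m 1 n" "M3 = 0\<^sub>m n 1"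
    using split[unfolded split_block_def Let_def] M entry0
    by (auto simp: mat_diag_def intro!: eq_matI)
  obtain U l where U: "U \<in> carrier_mat n n" "U\<^sup>T * U = 1\<^sub>m n" "U\<^sup>T * M4 * U = mat_diag n l"
    using Suc.IH[OF Mb(4) M4T] by blast
  \<comment> \<open>\<open>B\<close> fixes the first coordinate and applies \<open>U\<close> to the
    others; the diagonalizing matrix is \<open>W * B\<close>.\<close>
  define B where "B = four_block_mat (1\<^sub>m 1) (0\<^sub>m 1 n) (0\<^sub>m n 1) U"
  have B: "B \<in> carrier_mat ?N ?N" using U by (auto simp: B_def)
  have BT: "B\<^sup>T = four_block_mat (1\<^sub>m 1) (0\<^sub>m 1 n) (0\<^sub>m n 1) (U\<^sup>T)"
    unfolding B_def using U by (subst transpose_four_block_mat[of _ 1 1 _ n _ n]) auto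
  have BB: "B\<^sup>T * B = 1\<^sub>m ?N"
    unfolding BT unfolding B_def using U
    by (subst mult_four_block_mat[of _ 1 1 _ n _ n _ _ 1 _ n]) auto
  have "B\<^sup>T * M = four_block_mat M1 (0\<^sub>m 1 n) (0\<^sub>m n 1) (U\<^sup>T * M4)"
    unfolding BT Mb(5) using U Mb blocks(2,3)
    by (subst mult_four_block_mat[of _ 1 1 _ n _ n _ _ 1 _ n]) auto
  then have "B\<^sup>T * M * B = four_block_mat M1 (0\<^sub>m 1 n) (0\<^sub>m n 1) (mat_diag n l)"
    unfolding B_def using U Mb
    by (simp, subst mult_four_block_mat[of _ 1 1 _ n _ n _ _ 1 _ n]) auto
  also have "\<dots> = mat_diag ?N (\<lambda>i. if i = 0 then e else l (i - 1))"
    unfolding blocks mat_diag_def by (intro eq_matI) auto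
  finally have BMB: "B\<^sup>T * M * B = mat_diag ?N (\<lambda>i. if i = 0 then e else l (i - 1))" .
  have "(W * B)\<^sup>T * A * (W * B) = B\<^sup>T * M * B"
    unfolding M_def using W B A
    by (simp add: transpose_mult[of _ ?N ?N _ ?N] assoc_mult_mat[of _ ?N ?N _ ?N _ ?N])
  moreover have "(W * B)\<^sup>T * (W * B) = B\<^sup>T * (W\<^sup>T * W) * B"
    using W B by (simp add: transpose_mult[of _ ?N ?N _ ?N] assoc_mult_mat[of _ ?N ?N _ ?N _ ?N])
  then have "(W * B)\<^sup>T * (W * B) = 1\<^sub>m ?N" using B by (simp add: WW BB)
  ultimately show ?case using BMB W B by (intro exI[of _ "W * B"]) auto
qed

section \<open>Orthonormal eigenvectors and eigenvalues with multiplicity\<close>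

lemma proots_prod_linear_factors:
  fixes l :: "nat \<Rightarrow> 'a::idom"
  shows "proots (\<Prod>i\<leftarrow>xs. [:- l i, 1:]) = image_mset l (mset xs)"
proof (induction xs)
  case (Cons a xs)
  have "(\<Prod>i\<leftarrow>xs. [:- l i, 1:]) \<noteq> 0" by (auto simp: prod_list_zero_iff)
  then show ?case using Cons by (simp add: proots_mult del: mult_pCons_left)
qed simp

text \<open>The columns of the diagonalizing matrix become functions \<open>u i\<close>, so that
  later arguments are manipulations of finite sums. The last clause identifies \<open>l\<close> with
  the multiset behind \<open>nth_eigenvalue\<close>.\<close>

lemma real_symmetric_spectral_decomposition:
  fixes A :: "real mat"
  assumes A: "A \<in> carrier_mat n n" and sym: "A\<^sup>T = A"
  obtains u :: "nat \<Rightarrow> nat \<Rightarrow> real" and l :: "nat \<Rightarrow> real"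
  where "\<And>i j. i < n \<Longrightarrow> j < n \<Longrightarrow> (\<Sum>a<n. u i a * u j a) = (if i = j then 1 else 0)"
    and "\<And>a b. a < n \<Longrightarrow> b < n \<Longrightarrow> A $$ (a, b) = (\<Sum>i<n. l i * u i a * u i b)"
    and "proots (char_poly A) = image_mset l (mset_set {..<n})"
proof -
  obtain U l where U: "U \<in> carrier_mat n n" and UU: "U\<^sup>T * U = 1\<^sub>m n"
    and D: "U\<^sup>T * A * U = mat_diag n l"
    using real_symmetric_diagonalization[OF A sym] by blast
  have UT: "U\<^sup>T \<in> carrier_mat n n" using U by simp
  have UU': "U * U\<^sup>T = 1\<^sub>m n" using mat_mult_left_right_inverse[OF UT U UU] .
  have "U * mat_diag n l * U\<^sup>T = (U * U\<^sup>T) * A * (U * U\<^sup>T)"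
    using U UT A unfolding D[symmetric] by (simp add: assoc_mult_mat[of _ n n _ n _ n])
  then have AD: "A = U * mat_diag n l * U\<^sup>T" using A UU' by simp
  have sim: "similar_mat A (mat_diag n l)"
    unfolding similar_mat_def
    using similar_mat_witI[OF UU' UU AD A mat_diag_dim U UT] by blast
  have "char_poly A = (\<Prod>a\<leftarrow>diag_mat (mat_diag n l). [:- a, 1:])"
    unfolding char_poly_similar[OF sim]
    by (rule char_poly_upper_triangular[OF mat_diag_dim]) (auto simp: mat_diag_def)
  also have "diag_mat (mat_diag n l) = map l [0..<n]"
    by (auto simp: diag_mat_def mat_diag_def intro!: map_cong)
  finally have roots: "proots (char_poly A) = image_mset l (mset_set {..<n})"
    by (simp add: proots_prod_linear_factors comp_def atLeast0LessThan flip: mset_map)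
  show ?thesis
  proof (rule that[of "\<lambda>i a. U $$ (a, i)" l])
    show "(\<Sum>a<n. U $$ (a, i) * U $$ (a, j)) = (if i = j then 1 else 0)" if "i < n" "j < n" for i j
      using arg_cong[OF UU, of "\<lambda>M. M $$ (i, j)"] that U
      by (simp add: scalar_prod_def atLeast0LessThan)
    show "A $$ (a, b) = (\<Sum>i<n. l i * U $$ (a, i) * U $$ (b, i))" if "a < n" "b < n" for a b
      using that U unfolding AD
      by (simp add: mat_diag_mult_right[OF U] scalar_prod_def atLeast0LessThan mult_ac)
  qed (rule roots)
qed

section \<open>Sums of the largest elements\<close>

text \<open>Sort by \<open>f\<close> and reverse. Enumerating indices rather than values keeps track
  of which index carries each value, also among ties.\<close>

lemma decreasing_enumeration:
  fixes f :: "'i \<Rightarrow> 'b::linorder"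
  assumes "finite I"
  obtains xs where "distinct xs" "set xs = I" "sorted_wrt (\<lambda>a b. f a \<ge> f b) xs"
    "\<And>i. 1 \<le> i \<Longrightarrow> i \<le> card I \<Longrightarrow> nth_largest (image_mset f (mset_set I)) i = f (xs ! (i - 1))"
proof -
  obtain ys where ys: "set ys = I" "distinct ys" using finite_distinct_list[OF assms] by blast
  define zs where "zs = sort_key f ys"
  have mset: "mset zs = mset_set I"
    using ys by (metis mset_sort mset_set_set zs_def)
  have sorted: "sorted (map f zs)" by (simp add: zs_def)
  have "sorted_list_of_multiset (image_mset f (mset_set I)) = map f zs"
    using sorted by (metis mset mset_map sorted_list_of_multiset_mset sorted_sort_id)
  then have nth: "nth_largest (image_mset f (mset_set I)) i = map f (rev zs) ! (i - 1)" for i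
    by (simp add: nth_largest_def rev_map)
  show ?thesis
  proof
    show dz: "distinct (rev zs)" "set (rev zs) = I" using ys by (auto simp: zs_def)
    show "sorted_wrt (\<lambda>a b. f a \<ge> f b) (rev zs)"
      using sorted by (simp add: sorted_wrt_rev sorted_map)
    fix i :: nat assume "1 \<le> i" "i \<le> card I"
    moreover have "card I = length zs" using dz by (metis distinct_card length_rev)
    ultimately show "nth_largest (image_mset f (mset_set I)) i = f (rev zs ! (i - 1))"
      unfolding nth by (subst nth_map) auto
  qed
qed

text \<open>\<open>S\<close> consists of the first \<open>k\<close> indices of a decreasing
  enumeration. The map \<open>g\<close> lets one statement serve real eigenvalues and natural
  degrees cast to reals.\<close>

lemma top_sum_eq_sum_subset:
  fixes f :: "'i \<Rightarrow> 'b::linorder" and g :: "'b \<Rightarrow> real"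
  assumes I: "finite I" and k: "k \<le> card I"
  obtains S where "S \<subseteq> I" "card S = k" "\<And>a b. a \<in> S \<Longrightarrow> b \<in> I - S \<Longrightarrow> f a \<ge> f b"
    "(\<Sum>i=1..k. g (nth_largest (image_mset f (mset_set I)) i)) = (\<Sum>a\<in>S. g (f a))"
proof -
  obtain xs where xs: "distinct xs" "set xs = I" "sorted_wrt (\<lambda>a b. f a \<ge> f b) xs"
    and nth: "\<And>i. 1 \<le> i \<Longrightarrow> i \<le> card I \<Longrightarrow>
      nth_largest (image_mset f (mset_set I)) i = f (xs ! (i - 1))"
    using decreasing_enumeration[OF I] by blast
  have len: "length xs = card I" using xs distinct_card by metis
  have take: "set (take k xs) \<inter> set (drop k xs) = {}" "set xs = set (take k xs) \<union> set (drop k xs)"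
    using xs(1) by (auto simp: set_take_disj_set_drop_if_distinct simp flip: set_append)
  have sep: "\<forall>a\<in>set (take k xs). \<forall>b\<in>set (drop k xs). f a \<ge> f b"
    using xs(3) by (metis append_take_drop_id sorted_wrt_append)
  have "(\<Sum>i=1..k. g (nth_largest (image_mset f (mset_set I)) i)) = (\<Sum>i=1..k. g (f (xs ! (i - 1))))"
    using k nth by (intro sum.cong) auto
  also have "\<dots> = (\<Sum>i<k. g (f (xs ! i)))"
    by (rule sum.reindex_bij_witness[of _ Suc "\<lambda>i. i - 1"]) auto
  also have "\<dots> = sum_list (map (g \<circ> f) (take k xs))"
    using k len by (simp add: sum_list_sum_nth atLeast0LessThan)
  also have "\<dots> = (\<Sum>a\<in>set (take k xs). g (f a))"
    using xs(1) by (simp add: sum_list_distinct_conv_sum_set)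
  finally have "(\<Sum>i=1..k. g (nth_largest (image_mset f (mset_set I)) i)) = \<dots>" .
  moreover have "card (set (take k xs)) = k"
    using xs(1) k len by (simp add: distinct_card)
  ultimately show ?thesis using that[of "set (take k xs)"] take sep xs(2) by blast
qed

text \<open>Exchange argument: shifting weight from outside a top set \<open>S\<close> into it
  cannot decrease the sum. A threshold \<open>t\<close> between the values outside \<open>S\<close>
  and those inside does all shifts at once.\<close>

lemma weighted_sum_le_top_sum:
  fixes f :: "'i \<Rightarrow> nat" and x :: "'i \<Rightarrow> real"
  assumes I: "finite I" and x: "\<And>a. a \<in> I \<Longrightarrow> 0 \<le> x a \<and> x a \<le> 1" and sum_x: "sum x I \<le> real k"
  shows "(\<Sum>a\<in>I. real (f a) * x a)
    \<le> (\<Sum>i=1..min k (card I). real (nth_largest (image_mset f (mset_set I)) i))"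
proof -
  obtain S where S: "S \<subseteq> I" "card S = min k (card I)"
    and sep: "\<And>a b. a \<in> S \<Longrightarrow> b \<in> I - S \<Longrightarrow> f a \<ge> f b"
    and top: "(\<Sum>i=1..min k (card I). real (nth_largest (image_mset f (mset_set I)) i))
      = (\<Sum>a\<in>S. real (f a))"
    using top_sum_eq_sum_subset[OF I min.cobounded2, where g = real and f = f] by blast
  \<comment> \<open>When \<open>k\<close> exceeds \<open>card I\<close>, the bound comes from
    \<open>x a \<le> 1\<close> instead.\<close>
  have sum_x': "sum x I \<le> real (card S)"
    using sum_x sum_bounded_above[of I x 1] x S(2) by (simp add: min_def)
  \<comment> \<open>The largest value outside \<open>S\<close>; when \<open>S\<close> is all of
    \<open>I\<close>, 0 serves because the values are natural numbers.\<close>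
  define t where "t = (if I - S = {} then 0 else real (Max (f ` (I - S))))"
  have t_ge: "real (f b) \<le> t" if "b \<in> I - S" for b
    using that I by (auto simp: t_def)
  have t_le: "t \<le> real (f a)" if "a \<in> S" for a
    using that sep I by (auto simp: t_def)
  have "t \<ge> 0" by (simp add: t_def)
  have finS: "finite S" using S(1) I finite_subset by blast
  have split: "sum h I = sum h (I - S) + sum h S" for h :: "'i \<Rightarrow> real"
    using sum.subset_diff[OF S(1) I] .
  have "(\<Sum>a\<in>I. real (f a) * x a) - (\<Sum>a\<in>S. real (f a))
      = (\<Sum>a\<in>I - S. real (f a) * x a) - (\<Sum>a\<in>S. real (f a) * (1 - x a))"
    by (simp add: split sum_subtractf algebra_simps)
  also have "\<dots> \<le> (\<Sum>a\<in>I - S. t * x a) - (\<Sum>a\<in>S. t * (1 - x a))"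
    using S(1) x t_ge t_le by (intro diff_mono sum_mono mult_right_mono) auto
  also have "\<dots> = t * (sum x I - card S)"
    by (simp add: split sum_subtractf sum_distrib_left algebra_simps)
  \<comment> \<open>The total weight may fall short of \<open>card S\<close>, so the sign of
    \<open>t\<close> matters.\<close>
  also have "\<dots> \<le> 0" using \<open>t \<ge> 0\<close> sum_x' by (simp add: mult_nonneg_nonpos)
  finally show ?thesis using top by simp
qed

section \<open>Semidefinite matrices with diagonal blocks\<close>

text \<open>Semidefiniteness is applied to $x - \sum_{a \in T} ((L x)_a / L_{aa}) e_a$. Since $z / 0 = 0$, the
  terms with $L_{aa} = 0$ vanish.\<close>
lemma psd_diagonal_block_bound:
  fixes L :: "'i \<Rightarrow> 'i \<Rightarrow> real"
  assumes I: "finite I" "T \<subseteq> I"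
    and sym: "\<And>a b. a \<in> I \<Longrightarrow> b \<in> I \<Longrightarrow> L a b = L b a"
    and psd: "\<And>x. (\<Sum>a\<in>I. \<Sum>b\<in>I. L a b * x a * x b) \<ge> 0"
    and diag: "\<And>a b. a \<in> T \<Longrightarrow> b \<in> T \<Longrightarrow> a \<noteq> b \<Longrightarrow> L a b = 0"
  shows "(\<Sum>a\<in>T. (\<Sum>b\<in>I. L a b * x b)\<^sup>2 / L a a) \<le> (\<Sum>a\<in>I. \<Sum>b\<in>I. L a b * x a * x b)"
proof -
  define y where "y a = (\<Sum>b\<in>I. L a b * x b)" for a
  define c where "c a = (if a \<in> T then y a / L a a else 0)" for a
  have finT: "finite T" using I finite_subset by blast
  have restrict: "(\<Sum>a\<in>I. c a * h a) = (\<Sum>a\<in>T. y a / L a a * h a)" for h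
    using I by (intro sum.mono_neutral_cong_right) (auto simp: c_def)
  have cy: "(\<Sum>a\<in>I. c a * y a) = (\<Sum>a\<in>T. (y a)\<^sup>2 / L a a)"
    unfolding restrict by (simp add: power2_eq_square)
  \<comment> \<open>Inside the block only the diagonal entry survives, and \<open>c\<close> vanishes
    outside the block.\<close>
  have Lc: "(\<Sum>b\<in>I. c b * L a b) = c a * L a a" if "a \<in> T" for a
  proof -
    have "(\<Sum>b\<in>I. c b * L a b) = (\<Sum>b\<in>T. if a = b then c a * L a a else 0)"
      unfolding restrict using that diag by (intro sum.cong) (auto simp: c_def)
    then show ?thesis using that finT by simp
  qed
  have cc: "(\<Sum>a\<in>I. c a * (\<Sum>b\<in>I. c b * L a b)) = (\<Sum>a\<in>T. (y a)\<^sup>2 / L a a)"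
    unfolding restrict[of "\<lambda>a. \<Sum>b\<in>I. c b * L a b"]
    by (intro sum.cong refl) (simp add: Lc, simp add: c_def power2_eq_square)
  have xc: "(\<Sum>a\<in>I. \<Sum>b\<in>I. L a b * x a * c b) = (\<Sum>a\<in>I. c a * y a)"
    unfolding y_def sum_distrib_left
    by (subst sum.swap) (intro sum.cong refl, simp add: sym ac_simps)
  \<comment> \<open>In the expansion both cross terms and the term quadratic in \<open>c\<close>
    equal the sum to be bounded; with signs -, -, + one copy is subtracted.\<close>
  have "0 \<le> (\<Sum>a\<in>I. \<Sum>b\<in>I. L a b * (x a - c a) * (x b - c b))" by (rule psd)
  also have "\<dots> = (\<Sum>a\<in>I. \<Sum>b\<in>I. L a b * x a * x b) - (\<Sum>a\<in>I. \<Sum>b\<in>I. L a b * x a * c b)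
      - (\<Sum>a\<in>I. c a * y a) + (\<Sum>a\<in>I. c a * (\<Sum>b\<in>I. c b * L a b))"
    by (simp add: y_def sum_distrib_left algebra_simps sum.distrib sum_subtractf)
  also have "\<dots> = (\<Sum>a\<in>I. \<Sum>b\<in>I. L a b * x a * x b) - (\<Sum>a\<in>T. (y a)\<^sup>2 / L a a)"
    unfolding xc cy cc by simp
  finally show ?thesis by (simp add: y_def)
qed

text \<open>The analytic core, separated from the complex: \<open>T\<close> partitions the indices
  into diagonal blocks, and the top eigenvalue mass is spread over the coordinates and bounded block
  by block.\<close>

theorem top_eigenvalue_sum_le_of_diagonal_blocks:
  fixes A :: "real mat" and d :: "nat \<Rightarrow> nat"
  assumes A: "A \<in> carrier_mat n n" and sym: "A\<^sup>T = A"
    and psd: "\<And>x :: nat \<Rightarrow> real. (\<Sum>a<n. \<Sum>b<n. A $$ (a, b) * x a * x b) \<ge> 0"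
    and d: "\<And>a. a < n \<Longrightarrow> A $$ (a, a) = real (d a)"
    and T: "(\<Union>j\<in>J. T j) = {..<n}" "disjoint_family_on T J" "finite J"
    and diag: "\<And>j a b. j \<in> J \<Longrightarrow> a \<in> T j \<Longrightarrow> b \<in> T j \<Longrightarrow> a \<noteq> b \<Longrightarrow> A $$ (a, b) = 0"
    and k: "k \<le> n"
  shows "(\<Sum>i=1..k. nth_eigenvalue A i)
    \<le> (\<Sum>j\<in>J. \<Sum>i=1..min k (card (T j)). real (nth_largest (image_mset d (mset_set (T j))) i))"
proof -
  obtain u l where orth: "\<And>i j. i < n \<Longrightarrow> j < n \<Longrightarrow> (\<Sum>a<n. u i a * u j a) = (if i = j then 1 else 0)"
    and dec: "\<And>a b. a < n \<Longrightarrow> b < n \<Longrightarrow> A $$ (a, b) = (\<Sum>i<n. l i * u i a * u i b)"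
    and roots: "proots (char_poly A) = image_mset l (mset_set {..<n})"
    using real_symmetric_spectral_decomposition[OF A sym] by blast
  obtain S where S: "S \<subseteq> {..<n}" "card S = k" and top: "(\<Sum>i=1..k. nth_eigenvalue A i) = sum l S"
    using top_sum_eq_sum_subset[of "{..<n}" k l "\<lambda>x. x"] k
    unfolding nth_eigenvalue_def roots by auto
  have eig: "(\<Sum>b<n. A $$ (a, b) * u i b) = l i * u i a" if "a < n" "i < n" for a i
  proof -
    have "(\<Sum>b<n. A $$ (a, b) * u i b) = (\<Sum>b<n. \<Sum>j<n. l j * u j a * (u j b * u i b))"
      using that by (simp add: dec sum_distrib_right mult.assoc)
    also have "\<dots> = (\<Sum>j<n. l j * u j a * (\<Sum>b<n. u j b * u i b))"
      by (subst sum.swap) (simp add: sum_distrib_left)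
    also have "\<dots> = (\<Sum>j<n. if i = j then l i * u i a else 0)"
      using that by (intro sum.cong) (auto simp: orth)
    finally show ?thesis using that by simp
  qed
  have quad: "(\<Sum>a<n. \<Sum>b<n. A $$ (a, b) * u i a * u i b) = l i" if "i < n" for i
  proof -
    have "(\<Sum>a<n. \<Sum>b<n. A $$ (a, b) * u i a * u i b) = (\<Sum>a<n. u i a * (\<Sum>b<n. A $$ (a, b) * u i b))"
      by (simp add: sum_distrib_left ac_simps)
    also have "\<dots> = (\<Sum>a<n. u i a * (l i * u i a))"
      using that by (simp add: eig)
    also have "\<dots> = l i * (\<Sum>a<n. u i a * u i a)"
      by (simp add: sum_distrib_left ac_simps)
    finally show ?thesis using orth[OF that that] by simp
  qed
  have l_nonneg: "l i \<ge> 0" if "i < n" for i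
    using psd[of "u i"] quad[OF that] by simp
  define w where "w a = (\<Sum>i\<in>S. l i * (u i a)\<^sup>2)" for a
  have w_nonneg: "w a \<ge> 0" for a
    unfolding w_def using l_nonneg S(1) by (intro sum_nonneg) auto
  have w_le: "w a \<le> real (d a)" if "a < n" for a
  proof -
    \<comment> \<open>Adding the remaining nonnegative terms completes the sum to a diagonal
      entry.\<close>
    have "w a \<le> (\<Sum>i<n. l i * (u i a)\<^sup>2)"
      unfolding w_def using S(1) l_nonneg by (intro sum_mono2) auto
    also have "\<dots> = A $$ (a, a)" using that by (simp add: dec power2_eq_square mult.assoc)
    finally show ?thesis using d that by simp
  qed
  \<comment> \<open>Each \<open>u i\<close> is a unit vector, so summing \<open>w\<close> over all
    coordinates recovers the eigenvalues in \<open>S\<close>.\<close>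
  have "(\<Sum>i=1..k. nth_eigenvalue A i) = (\<Sum>i\<in>S. l i * (\<Sum>a<n. u i a * u i a))"
    unfolding top using S(1) orth by (intro sum.cong) auto
  also have "\<dots> = (\<Sum>a<n. w a)"
    unfolding w_def by (subst sum.swap) (simp add: sum_distrib_left power2_eq_square)
  also have "\<dots> = (\<Sum>j\<in>J. \<Sum>a\<in>T j. w a)"
    unfolding T(1)[symmetric] using T
    by (intro sum.UNION_disjoint) (auto simp: disjoint_family_on_def intro: finite_subset[of _ "{..<n}"])
  also have "\<dots> \<le> (\<Sum>j\<in>J. \<Sum>i=1..min k (card (T j)). real (nth_largest (image_mset d (mset_set (T j))) i))"
  proof (rule sum_mono)
    fix j assume j: "j \<in> J"
    then have Tj: "T j \<subseteq> {..<n}" using T(1) by blast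
    define x where "x a = w a / real (d a)" for a
    have "sum x (T j) = (\<Sum>i\<in>S. \<Sum>a\<in>T j. l i * (u i a)\<^sup>2 / real (d a))"
      unfolding x_def w_def sum_divide_distrib by (rule sum.swap)
    also have "\<dots> \<le> (\<Sum>i\<in>S. 1)"
    proof (rule sum_mono)
      fix i assume "i \<in> S"
      then have i: "i < n" using S(1) by auto
      have "(\<Sum>a\<in>T j. (\<Sum>b<n. A $$ (a, b) * u i b)\<^sup>2 / A $$ (a, a)) \<le> l i"
        unfolding quad[OF i, symmetric]
      proof (rule psd_diagonal_block_bound[OF _ Tj])
        show "A $$ (a, b) = A $$ (b, a)" if "a \<in> {..<n}" "b \<in> {..<n}" for a b
          using that A arg_cong[OF sym, of "\<lambda>M. M $$ (a, b)"] by auto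
      qed (use psd diag j in auto)
      also have "(\<Sum>a\<in>T j. (\<Sum>b<n. A $$ (a, b) * u i b)\<^sup>2 / A $$ (a, a))
          = (\<Sum>a\<in>T j. l i * (l i * (u i a)\<^sup>2 / real (d a)))"
        using Tj i by (intro sum.cong refl) (auto simp: eig d power2_eq_square subset_iff)
      also have "\<dots> = l i * (\<Sum>a\<in>T j. l i * (u i a)\<^sup>2 / real (d a))"
        by (simp add: sum_distrib_left)
      \<comment> \<open>The block inequality reads \<open>l i\<close> times this sum
        \<open>\<le>\<close> \<open>l i\<close>. Cancel \<open>l i\<close>, or note that the sum is
        0 when \<open>l i = 0\<close>.\<close>
      finally show "(\<Sum>a\<in>T j. l i * (u i a)\<^sup>2 / real (d a)) \<le> 1"
        using l_nonneg[OF i] by (cases "l i = 0") auto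
    qed
    finally have sum_x: "sum x (T j) \<le> real k" using S(2) by simp
    have x: "0 \<le> x a \<and> x a \<le> 1" if "a \<in> T j" for a
      using that Tj w_nonneg[of a] w_le[of a] by (auto simp: x_def divide_le_eq_1 subset_iff)
    \<comment> \<open>If \<open>d a = 0\<close>, then \<open>w a\<close> is squeezed to 0, so the
      identity survives division by zero.\<close>
    have "w a = real (d a) * x a" if "a \<in> T j" for a
      using that Tj w_nonneg[of a] w_le[of a] by (cases "d a = 0") (auto simp: x_def subset_iff)
    then have "(\<Sum>a\<in>T j. w a) = (\<Sum>a\<in>T j. real (d a) * x a)" by simp
    also have "\<dots> \<le> (\<Sum>i=1..min k (card (T j)). real (nth_largest (image_mset d (mset_set (T j))) i))"
      using Tj finite_subset x sum_x by (intro weighted_sum_le_top_sum) auto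
    finally show "(\<Sum>a\<in>T j. w a)
      \<le> (\<Sum>i=1..min k (card (T j)). real (nth_largest (image_mset d (mset_set (T j))) i))" .
  qed
  finally show ?thesis .
qed

section \<open>The upper Laplacian of a partite complex\<close>

lemma mem_faces_card:
  "\<sigma> \<in> faces X (int r - 1) \<longleftrightarrow> \<sigma> \<in> X \<and> card \<sigma> = r"
  "\<sigma> \<in> faces X (int r) \<longleftrightarrow> \<sigma> \<in> X \<and> card \<sigma> = r + 1"
  by (auto simp: faces_def simplex_dim_def)

text \<open>The sign rule behind the vanishing of the boundary of a boundary. Adding the other
  vertex flips the sign of the larger of \<open>a\<close> and \<open>b\<close> only, so exactly one
  factor changes.\<close>

lemma incidence_sign_anticommute:
  assumes lt: "strict_linear_order_on V lt"
    and ab: "a \<in> V" "b \<in> V" "a \<noteq> b" "a \<notin> S" "b \<notin> S" "finite S"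
  shows "incidence_sign lt (insert a (insert b S)) (insert a S)
      * incidence_sign lt (insert a (insert b S)) (insert b S)
    = - (incidence_sign lt (insert a S) S * incidence_sign lt (insert b S) S)"
proof -
  \<comment> \<open>\<open>x\<close> may lie in \<open>R\<close> or not; by irreflexivity its
    presence does not change the count.\<close>
  define s :: "'a \<Rightarrow> 'a set \<Rightarrow> real" where "s x R = (-1) ^ card {v \<in> R. (v, x) \<in> lt}" for x R
  have s_insert: "s x (insert y R) = (if (y, x) \<in> lt then - s x R else s x R)"
    if "finite R" "y \<notin> R" for x y R
  proof -
    have "{v \<in> insert y R. (v, x) \<in> lt}
        = (if (y, x) \<in> lt then insert y {v \<in> R. (v, x) \<in> lt} else {v \<in> R. (v, x) \<in> lt})"
      by auto
    then show ?thesis using that by (simp add: s_def)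
  qed
  have sign: "incidence_sign lt R Q = s x R" if "R - Q = {x}" for R Q x
    by (simp add: incidence_sign_def s_def that)
  have irr: "(x, x) \<notin> lt" for x
    using lt by (auto simp: strict_linear_order_on_def irrefl_def)
  have "(a, b) \<in> lt \<longleftrightarrow> (b, a) \<notin> lt"
    using lt ab by (auto simp: strict_linear_order_on_def irrefl_def total_on_def dest: transD)
  moreover have "incidence_sign lt (insert a (insert b S)) (insert a S) = s b (insert a (insert b S))"
    "incidence_sign lt (insert a (insert b S)) (insert b S) = s a (insert a (insert b S))"
    "incidence_sign lt (insert a S) S = s a (insert a S)"
    "incidence_sign lt (insert b S) S = s b (insert b S)"
    using ab by (auto intro!: sign)
  ultimately show ?thesis using ab irr by (simp add: s_insert)
qed

text \<open>The matrix of the signed boundary operator from r-chains to (r-1)-chains, with row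
  \<open>\<tau>\<close> and column \<open>\<sigma>\<close>.\<close>

definition boundary_entry :: "'a rel \<Rightarrow> 'a set \<Rightarrow> 'a set \<Rightarrow> real" where
  "boundary_entry lt \<tau> \<sigma> = (if \<tau> \<subseteq> \<sigma> then incidence_sign lt \<sigma> \<tau> else 0)"

text \<open>The Laplacian is the boundary matrix times its transpose. On the diagonal squared signs
  count cofaces; off the diagonal the only possible common coface is
  \<open>\<tau> \<union> \<eta>\<close>.\<close>

lemma upper_laplacian_entry_eq_sum:
  assumes X: "simplicial_complex V X" and lt: "strict_linear_order_on V lt" and r: "r \<ge> 1"
    and faces: "\<tau> \<in> faces X (int r - 1)" "\<eta> \<in> faces X (int r - 1)"
  shows "upper_laplacian_entry lt X r \<tau> \<eta>
    = (\<Sum>\<sigma>\<in>faces X (int r). boundary_entry lt \<tau> \<sigma> * boundary_entry lt \<eta> \<sigma>)"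
proof -
  have finX: "finite X" using X unfolding simplicial_complex_def by (meson finite_Pow_iff finite_subset)
  then have fin: "finite (faces X (int r))" by (simp add: faces_def)
  show ?thesis
  proof (cases "\<tau> = \<eta>")
    case True
    have "(\<Sum>\<sigma>\<in>faces X (int r). boundary_entry lt \<tau> \<sigma> * boundary_entry lt \<tau> \<sigma>)
        = (\<Sum>\<sigma>\<in>faces X (int r). if \<tau> \<subseteq> \<sigma> then 1 else 0)"
      by (intro sum.cong refl)
        (auto simp: boundary_entry_def incidence_sign_def simp flip: power_add mult_2)
    then show ?thesis
      using True fin by (simp add: upper_laplacian_entry_def r_degree_def sum.If_cases Int_def)
  next
    case False
    have sub: "\<tau> \<in> X" "\<eta> \<in> X" "card \<tau> = r" "card \<eta> = r"
      using faces by (auto simp: mem_faces_card)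
    then have subV: "\<tau> \<subseteq> V" "\<eta> \<subseteq> V" "finite V" using X by (auto simp: simplicial_complex_def)
    then have fins: "finite \<tau>" "finite \<eta>" using finite_subset by auto
    have card_un: "card (\<tau> \<union> \<eta>) + card (\<tau> \<inter> \<eta>) = 2 * r"
      using card_Un_Int[OF fins] sub by simp
    have "card (\<tau> \<inter> \<eta>) < r"
      using False sub fins
      by (metis card_subset_eq inf_le1 inf_le2 card_mono le_neq_implies_less)
    then have un_gt: "card (\<tau> \<union> \<eta>) \<ge> r + 1" using card_un by simp
    have eq_un: "\<sigma> = \<tau> \<union> \<eta>" if "\<sigma> \<in> faces X (int r)" "\<tau> \<subseteq> \<sigma>" "\<eta> \<subseteq> \<sigma>" for \<sigma>
    proof -
      have card: "card \<sigma> = r + 1" using that by (simp add: mem_faces_card)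
      then have "finite \<sigma>" by (intro card_ge_0_finite) simp
      then show ?thesis
        using that un_gt card card_seteq[of \<sigma> "\<tau> \<union> \<eta>"] by simp
    qed
    have zero: "boundary_entry lt \<tau> \<sigma> * boundary_entry lt \<eta> \<sigma> = 0"
      if "\<sigma> \<in> faces X (int r)" "\<sigma> \<noteq> \<tau> \<union> \<eta>" for \<sigma>
      using eq_un[of \<sigma>] that by (cases "\<tau> \<subseteq> \<sigma> \<and> \<eta> \<subseteq> \<sigma>") (auto simp: boundary_entry_def)
    show ?thesis
    proof (cases "\<tau> \<union> \<eta> \<in> faces X (int r)")
      case un: True
      then have card_int: "card (\<tau> \<inter> \<eta>) = r - 1" "\<tau> \<union> \<eta> \<in> X"
        using card_un by (auto simp: mem_faces_card)
      define S where "S = \<tau> \<inter> \<eta>"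
      have finS: "finite S" and subS: "S \<subseteq> \<tau>" "S \<subseteq> \<eta>" using fins by (auto simp: S_def)
      have "card (\<tau> - S) = 1" "card (\<eta> - S) = 1"
        using sub(3,4) r card_int(1) card_Diff_subset[OF finS subS(1)] card_Diff_subset[OF finS subS(2)]
        by (simp_all add: S_def[symmetric])
      then obtain a b where a: "\<tau> - S = {a}" and b: "\<eta> - S = {b}" by (metis card_1_singletonE)
      have ab: "\<tau> = insert a S" "\<eta> = insert b S" "a \<notin> S" "b \<notin> S"
        using a b subS by blast+
      have "a \<noteq> b" using False ab by blast
      have ab_V: "a \<in> V" "b \<in> V" using ab subV by blast+
      have un_ab: "\<tau> \<union> \<eta> = insert a (insert b S)" using ab by auto
      have "(\<Sum>\<sigma>\<in>faces X (int r). boundary_entry lt \<tau> \<sigma> * boundary_entry lt \<eta> \<sigma>)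
          = (\<Sum>\<sigma>\<in>{\<tau> \<union> \<eta>}. boundary_entry lt \<tau> \<sigma> * boundary_entry lt \<eta> \<sigma>)"
        using un fin zero by (intro sum.mono_neutral_right) auto
      also have "\<dots> = incidence_sign lt (\<tau> \<union> \<eta>) \<tau> * incidence_sign lt (\<tau> \<union> \<eta>) \<eta>"
        by (simp add: boundary_entry_def)
      \<comment> \<open>Signs relative to the union are traded for signs relative to the
        intersection, as in the definition of the Laplacian.\<close>
      also have "\<dots> = - (incidence_sign lt \<tau> S * incidence_sign lt \<eta> S)"
        unfolding un_ab using incidence_sign_anticommute[OF lt ab_V \<open>a \<noteq> b\<close> ab(3,4) finS] ab(1,2)
        by simp
      finally show ?thesis using False card_int by (simp add: upper_laplacian_entry_def S_def)
    next
      case un: False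
      \<comment> \<open>An intersection of \<open>r - 1\<close> vertices forces a union of
        \<open>r + 1\<close>, so membership of the union in \<open>X\<close> would make it an
        r-face, contrary to \<open>un\<close>.\<close>
      have "card (\<tau> \<union> \<eta>) = r + 1" if "card (\<tau> \<inter> \<eta>) = r - 1" using that card_un r by simp
      with un have "upper_laplacian_entry lt X r \<tau> \<eta> = 0"
        using False by (auto simp: upper_laplacian_entry_def mem_faces_card)
      moreover have "(\<Sum>\<sigma>\<in>faces X (int r). boundary_entry lt \<tau> \<sigma> * boundary_entry lt \<eta> \<sigma>) = 0"
        using un zero by (intro sum.neutral ballI) metis
      ultimately show ?thesis by simp
    qed
  qed
qed

section \<open>Faces and the partite sets they miss\<close>

lemma partite_card_eq:
  assumes "partite_complex V X r P" "\<sigma> \<in> X"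
  shows "card \<sigma> + card {i \<in> {1..r+1}. \<sigma> \<inter> P i = {}} = r + 1"
proof -
  have V: "finite V" "\<sigma> \<subseteq> V" "(\<Union>i\<in>{1..r+1}. P i) = V" "disjoint_family_on P {1..r+1}"
    and le: "\<And>i. i \<in> {1..r+1} \<Longrightarrow> card (\<sigma> \<inter> P i) \<le> 1"
    using assms unfolding partite_complex_def simplicial_complex_def by blast+
  have fin: "finite \<sigma>" using V finite_subset by blast
  \<comment> \<open>The parts cut the simplex into pieces of size 0 or 1, so its vertices correspond
    to the parts it meets.\<close>
  have "\<sigma> = (\<Union>i\<in>{1..r+1}. \<sigma> \<inter> P i)" using V by blast
  then have "card \<sigma> = card (\<Union>i\<in>{1..r+1}. \<sigma> \<inter> P i)" by simp
  also have "\<dots> = (\<Sum>i\<in>{1..r+1}. card (\<sigma> \<inter> P i))"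
    using V(4) fin by (intro card_UN_disjoint) (auto simp: disjoint_family_on_def)
  also have "\<dots> = (\<Sum>i\<in>{1..r+1}. if \<sigma> \<inter> P i = {} then 0 else 1)"
  proof (intro sum.cong refl)
    fix i assume "i \<in> {1..r+1}"
    then show "card (\<sigma> \<inter> P i) = (if \<sigma> \<inter> P i = {} then 0 else 1)"
      using le[of i] fin by (cases "\<sigma> \<inter> P i = {}") (auto simp: le_Suc_eq)
  qed
  also have "\<dots> = card ({1..r+1} - {i \<in> {1..r+1}. \<sigma> \<inter> P i = {}})"
    unfolding card_eq_sum by (intro sum.mono_neutral_cong_right) auto
  also have "\<dots> = r + 1 - card {i \<in> {1..r+1}. \<sigma> \<inter> P i = {}}"
    by (subst card_Diff_subset) auto
  finally show ?thesis
    using card_mono[of "{1..r+1}" "{i \<in> {1..r+1}. \<sigma> \<inter> P i = {}}"] by fastforce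
qed

text \<open>With \<open>r\<close> vertices in \<open>r + 1\<close> parts, exactly one part is
  missed. Hence the families \<open>faces_avoiding\<close> partition the (r-1)-faces.\<close>

lemma partite_facet_avoids_unique_part:
  assumes "partite_complex V X r P" "\<sigma> \<in> faces X (int r - 1)"
  shows "\<exists>!j. j \<in> {1..r+1} \<and> \<sigma> \<inter> P j = {}"
proof -
  have "card {i \<in> {1..r+1}. \<sigma> \<inter> P i = {}} = 1"
    using partite_card_eq[OF assms(1)] assms(2) by (fastforce simp: mem_faces_card)
  then obtain j where "{i \<in> {1..r+1}. \<sigma> \<inter> P i = {}} = {j}" by (auto simp: card_1_singleton_iff)
  then show ?thesis by (intro ex1I[of _ j]) blast+
qed

text \<open>A nonzero entry would need \<open>\<tau> \<union> \<eta>\<close> to be a simplex with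
  \<open>r + 1\<close> vertices, but a simplex missing \<open>P j\<close> has at most
  \<open>r\<close>.\<close>

lemma upper_laplacian_entry_faces_avoiding:
  assumes part: "partite_complex V X r P" and r: "r \<ge> 1" and j: "j \<in> {1..r+1}"
    and "\<tau> \<in> faces_avoiding X (int r - 1) (P j)" "\<eta> \<in> faces_avoiding X (int r - 1) (P j)"
    and ne: "\<tau> \<noteq> \<eta>"
  shows "upper_laplacian_entry lt X r \<tau> \<eta> = 0"
proof -
  have \<tau>\<eta>: "\<tau> \<in> X" "\<eta> \<in> X" "card \<tau> = r" "card \<eta> = r" "(\<tau> \<union> \<eta>) \<inter> P j = {}"
    using assms by (auto simp: faces_avoiding_def mem_faces_card)
  then have "finite \<tau>" "finite \<eta>"
    using r by (auto intro: card_ge_0_finite)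
  then have "card (\<tau> \<union> \<eta>) + card (\<tau> \<inter> \<eta>) = 2 * r"
    using card_Un_Int[of \<tau> \<eta>] \<tau>\<eta> by simp
  moreover have "card (\<tau> \<union> \<eta>) \<le> r" if "\<tau> \<union> \<eta> \<in> X"
  proof -
    have "{i \<in> {1..r+1}. (\<tau> \<union> \<eta>) \<inter> P i = {}} \<noteq> {}" using j \<tau>\<eta>(5) by blast
    then have "card {i \<in> {1..r+1}. (\<tau> \<union> \<eta>) \<inter> P i = {}} \<noteq> 0" by (subst card_0_eq) auto
    then show ?thesis using partite_card_eq[OF part that] by linarith
  qed
  ultimately show ?thesis
    using ne r by (auto simp: upper_laplacian_entry_def)
qed

section \<open>From faces to matrix indices\<close>

theorem theorem1p9:
  fixes V :: "'a set" and X :: "'a set set" and P :: "nat \<Rightarrow> 'a set"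
    and lt :: "'a rel" and fs :: "'a set list" and r k :: nat
  assumes "r \<ge> 1"
    and "partite_complex V X r P"
    and "strict_linear_order_on V lt"
    and "distinct fs" and "set fs = faces X (int r - 1)"
    and "1 \<le> k" and "k \<le> card (faces X (int r - 1))"
  shows "(\<Sum>i=1..k. nth_eigenvalue (upper_laplacian lt X r fs) i)
    \<le> (\<Sum>j=1..r+1. \<Sum>i=1..min k (card (faces_avoiding X (int r - 1) (P j))).
          real (degree_seq X r (P j) i))"
proof -
  let ?F = "faces X (int r - 1)"
  define n where "n = length fs"
  define A where "A = upper_laplacian lt X r fs"
  define d where "d a = r_degree X r (fs ! a)" for a
  define T where "T j = {a. a < n \<and> fs ! a \<inter> P j = {}}" for j
  have X: "simplicial_complex V X" using assms(2) by (simp add: partite_complex_def)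
  have mem: "fs ! a \<in> ?F" if "a < n" for a
    using that assms(5) by (metis n_def nth_mem)
  have A: "A \<in> carrier_mat n n" by (simp add: A_def n_def upper_laplacian_def)
  have entry: "A $$ (a, b) = upper_laplacian_entry lt X r (fs ! a) (fs ! b)" if "a < n" "b < n" for a b
    using that by (simp add: A_def n_def upper_laplacian_def)
  define B where "B a \<sigma> = boundary_entry lt (fs ! a) \<sigma>" for a \<sigma>
  have entry_sum: "A $$ (a, b) = (\<Sum>\<sigma>\<in>faces X (int r). B a \<sigma> * B b \<sigma>)" if "a < n" "b < n" for a b
    using that entry upper_laplacian_entry_eq_sum[OF X assms(3,1) mem mem] by (simp add: B_def)
  have sym: "A\<^sup>T = A"
    using A by (intro eq_matI) (auto simp: entry_sum mult.commute)
  \<comment> \<open>The quadratic form is the squared norm of the transposed boundary matrix applied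
    to \<open>x\<close>.\<close>
  have psd: "(\<Sum>a<n. \<Sum>b<n. A $$ (a, b) * x a * x b) \<ge> 0" for x
  proof -
    have "(\<Sum>a<n. \<Sum>b<n. A $$ (a, b) * x a * x b)
        = (\<Sum>a<n. \<Sum>b<n. \<Sum>\<sigma>\<in>faces X (int r). (B a \<sigma> * x a) * (B b \<sigma> * x b))"
      by (intro sum.cong refl) (simp add: entry_sum sum_distrib_left sum_distrib_right ac_simps)
    also have "\<dots> = (\<Sum>a<n. \<Sum>\<sigma>\<in>faces X (int r). \<Sum>b<n. (B a \<sigma> * x a) * (B b \<sigma> * x b))"
      by (intro sum.cong refl sum.swap)
    also have "\<dots> = (\<Sum>\<sigma>\<in>faces X (int r). \<Sum>a<n. \<Sum>b<n. (B a \<sigma> * x a) * (B b \<sigma> * x b))"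
      by (rule sum.swap)
    also have "\<dots> = (\<Sum>\<sigma>\<in>faces X (int r). (\<Sum>a<n. B a \<sigma> * x a)\<^sup>2)"
      by (simp add: power2_eq_square sum_product)
    finally show ?thesis by (simp add: sum_nonneg)
  qed
  have T_image: "(!) fs ` T j = faces_avoiding X (int r - 1) (P j)" for j
  proof (intro equalityI subsetI)
    fix \<sigma> assume "\<sigma> \<in> faces_avoiding X (int r - 1) (P j)"
    then have "\<sigma> \<in> set fs" "\<sigma> \<inter> P j = {}" using assms(5) by (auto simp: faces_avoiding_def)
    then show "\<sigma> \<in> (!) fs ` T j" by (auto simp: T_def n_def in_set_conv_nth)
  qed (use mem in \<open>auto simp: T_def faces_avoiding_def\<close>)
  have T_inj: "inj_on ((!) fs) (T j)" for j
    using assms(4) by (auto simp: T_def n_def inj_on_def nth_eq_iff_index_eq)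
  have card_T: "card (T j) = card (faces_avoiding X (int r - 1) (P j))" for j
    using card_image[OF T_inj] T_image by metis
  \<comment> \<open>\<open>fs\<close> is injective on the indices, so reindexing preserves the
    multiplicities of the degrees.\<close>
  have degrees: "image_mset d (mset_set (T j))
      = image_mset (r_degree X r) (mset_set (faces_avoiding X (int r - 1) (P j)))" for j
    unfolding T_image[symmetric] image_mset_mset_set[OF T_inj, symmetric]
    by (simp add: multiset.map_comp comp_def d_def[abs_def])
  have "(\<Sum>i=1..k. nth_eigenvalue A i) \<le> (\<Sum>j\<in>{1..r+1}. \<Sum>i=1..min k (card (T j)).
      real (nth_largest (image_mset d (mset_set (T j))) i))"
  proof (rule top_eigenvalue_sum_le_of_diagonal_blocks[OF A sym psd])
    show "A $$ (a, a) = real (d a)" if "a < n" for a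
      using that by (simp add: entry d_def upper_laplacian_entry_def)
    \<comment> \<open>Existence of the missed part gives the covering; its uniqueness gives
      disjointness.\<close>
    show "(\<Union>j\<in>{1..r+1}. T j) = {..<n}"
      using partite_facet_avoids_unique_part[OF assms(2) mem] by (fastforce simp: T_def)
    show "disjoint_family_on T {1..r+1}"
      using partite_facet_avoids_unique_part[OF assms(2) mem]
      unfolding T_def disjoint_family_on_def by blast
    show "A $$ (a, b) = 0" if "j \<in> {1..r+1}" "a \<in> T j" "b \<in> T j" "a \<noteq> b" for j a b
    proof -
      have "fs ! a \<noteq> fs ! b" using inj_onD[OF T_inj] that by blast
      moreover have "fs ! a \<in> faces_avoiding X (int r - 1) (P j)"
        "fs ! b \<in> faces_avoiding X (int r - 1) (P j)"
        using T_image[of j] that(2,3) by blast+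
      ultimately show ?thesis
        using upper_laplacian_entry_faces_avoiding[OF assms(2,1) that(1)] entry that(2,3)
        by (simp add: T_def)
    qed
    show "k \<le> n" using assms(4,5,7) by (metis distinct_card n_def)
  qed auto
  then show ?thesis by (simp add: A_def card_T degrees degree_seq_def)
qed

end
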